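(* Let $G$ be a finite group and $V$ a finite-dimensional $\mathbb{Q}[G]$-module such that $V\otimes_{\mathbb{Q}}\mathbb{R}$ has a $G$-invariant complex structure $J$. Let $\mathfrak{D}(G)$ be the set of $G$-invariant complex structures on $V\otimes_{\mathbb{Q}}\mathbb{R}$. Then $J$ may be continuously deformed in $\mathfrak{D}(G)$ to a polarisable $G$-invariant complex structure $J'$; that is, there is a continuous map $[0,1]\to\mathfrak{D}(G)$, $t\mapsto J_t$, with $J_0=J$ and $J_1=J'$ polarisable. Moreover, the subset $\mathfrak{D}(G)_p$ of polarisable elements of $\mathfrak{D}(G)$ is dense in $\mathfrak{D}(G)$.
   Context: A $G$-invariant complex structure on $V\otimes_{\mathbb{Q}}\mathbb{R}$ is an $\mathbb{R}$-linear endomorphism $J$ with $J^2=-\mathrm{id}$ commuting with the action of $G$. $\mathfrak{D}(G)$ carries the subspace topology from the finite-dimensional real vector space $\mathrm{End}_{\mathbb{R}}(V\otimes_{\mathbb{Q}}\mathbb{R})$. A complex structure $J$ on $V\otimes_{\mathbb{Q}}\mathbb{R}$ is polarisable if there is an alternating two-form $\omega$ on $V\otimes_{\mathbb{Q}}\mathbb{R}$ such that $\omega(J\cdot,J\cdot)=\omega(\cdot,\cdot)$, $\omega(J\cdot,\cdot)$ is positive definite, and $\omega(\Lambda,\Lambda)\subseteq\mathbb{Z}$ for a lattice $\Lambda\subset V$ (a finitely generated subgroup of $V$ spanning $V$ over $\mathbb{Q}$; after rescaling $\omega$ the choice of $\Lambda$ is irrelevant). *)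

theory Defs
  imports
    "HOL-Analysis.Analysis"
    "HOL-Algebra.Group_Action"
    "HOL-Computational_Algebra.Group_Closure"
begin

text \<open>
  The rational vector space \<open>V\<close> is the type \<open>'v\<close> with scalar multiplication \<open>scl\<close>; dimension
  zero is allowed. A \<open>\<rat>[G]\<close>-module structure on it is the same as an action \<open>\<rho>\<close> of \<open>G\<close> by
  \<open>\<rat>\<close>-linear maps.
\<close>

definition fin_dim_rational_module ::
    "('g, 'm) monoid_scheme \<Rightarrow> (rat \<Rightarrow> 'v \<Rightarrow> 'v::ab_group_add) \<Rightarrow> ('g \<Rightarrow> 'v \<Rightarrow> 'v) \<Rightarrow> bool"
  where "fin_dim_rational_module G scl \<rho> \<longleftrightarrow>
    (\<exists>B. finite_dimensional_vector_space scl B) \<and>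
    group_action G UNIV \<rho> \<and>
    (\<forall>g\<in>carrier G. Vector_Spaces.linear scl scl (\<rho> g))"

abbreviation scaleQ :: "rat \<Rightarrow> 'a::real_vector \<Rightarrow> 'a"
  where "scaleQ q x \<equiv> of_rat q *\<^sub>R x"

text \<open>
  \<open>scalar_extension scl \<iota>\<close> says that the real vector space \<open>'w\<close>, together with
  \<open>\<iota> = (\<lambda>v. v \<otimes> 1)\<close>, is \<open>V \<otimes>\<^sub>\<rat> \<real>\<close>: it is free over the image of a
  \<open>\<rat>\<close>-basis of \<open>V\<close>. This determines \<open>('w, \<iota>)\<close> up to unique isomorphism, as
  \<open>scalar_extension_universal\<close> below is the universal property of the tensor product.
\<close>

definition scalar_extension ::
    "(rat \<Rightarrow> 'v \<Rightarrow> 'v::ab_group_add) \<Rightarrow> ('v \<Rightarrow> 'w::real_vector) \<Rightarrow> bool"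
  where "scalar_extension scl \<iota> \<longleftrightarrow>
    Vector_Spaces.linear scl scaleQ \<iota> \<and>
    (\<exists>B. \<not> module.dependent scl B \<and> module.span scl B = UNIV \<and>
         inj_on \<iota> B \<and> independent (\<iota> ` B) \<and> span (\<iota> ` B) = UNIV)"

lemma scalar_extension_universal:
  fixes \<iota> :: "'v::ab_group_add \<Rightarrow> 'w::real_vector" and f :: "'v \<Rightarrow> 'u::real_vector"
  assumes ext: "scalar_extension scl \<iota>"
    and f: "Vector_Spaces.linear scl scaleQ f"
  shows "\<exists>!T. linear T \<and> (\<forall>v. T (\<iota> v) = f v)"
proof -
  have lin: "Vector_Spaces.linear scl scaleQ \<iota>"
    using ext by (simp add: scalar_extension_def)
  interpret i: Vector_Spaces.linear scl scaleQ \<iota> by (fact lin)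
  interpret f: Vector_Spaces.linear scl scaleQ f by (fact f)
  obtain B where B: "i.vs1.span B = UNIV" "inj_on \<iota> B"
      "independent (\<iota> ` B)" "span (\<iota> ` B) = UNIV"
    using ext unfolding scalar_extension_def by blast
  have on_basis: "T (\<iota> v) = f v"
    if T: "linear T" and eq: "\<And>b. b \<in> B \<Longrightarrow> T (\<iota> b) = f b" for T v
  proof -
    have "v \<in> i.vs1.span B" using B by simp
    then show ?thesis
    proof (induction rule: i.vs1.span_induct_alt)
      case base
      show ?case using T by (simp add: linear_0 i.zero f.zero)
    next
      case (step c x y)
      then show ?case
        using T eq by (simp add: i.add i.scale f.add f.scale linear_add linear_scale)
    qed
  qed
  define T where "T = construct (\<iota> ` B) (\<lambda>w. f (the_inv_into B \<iota> w))"
  have T: "linear T"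
    unfolding T_def by (rule linear_construct) (use B in simp)
  have "T (\<iota> b) = f b" if "b \<in> B" for b
    using B that by (simp add: T_def construct_basis the_inv_into_f_f)
  then have ex: "linear T \<and> (\<forall>v. T (\<iota> v) = f v)"
    using on_basis T by blast
  have "S = T" if "linear S \<and> (\<forall>v. S (\<iota> v) = f v)" for S
  proof
    fix w
    show "S w = T w"
      by (rule linear_eq_on[of S T w "\<iota> ` B"]) (use that ex B in auto)
  qed
  with ex show ?thesis by blast
qed

lemma scalar_extension_vec:
  "scalar_extension (\<lambda>q (v::rat^'n). q *s v) (\<lambda>v. (\<chi> i. of_rat (v $ i)) :: real^'n)"
proof -
  let ?i = "\<lambda>v::rat^'n. (\<chi> i. of_rat (v $ i)) :: real^'n"
  have ax: "?i (axis k 1) = axis k 1" for k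
    by (simp add: axis_def vec_eq_iff)
  have lin: "Vector_Spaces.linear (*s) scaleQ ?i"
    by unfold_locales (simp_all add: vec_eq_iff of_rat_add of_rat_mult algebra_simps)
  have im: "?i ` cart_basis = Basis"
  proof -
    have "?i ` cart_basis = range (\<lambda>k. ?i (axis k 1))"
      unfolding cart_basis_def by blast
    also have "\<dots> = Basis"
      unfolding ax by (auto simp: Basis_vec_def)
    finally show ?thesis .
  qed
  have inj: "inj_on ?i cart_basis"
    by (auto simp: inj_on_def vec_eq_iff)
  show ?thesis
    unfolding scalar_extension_def
    using lin im inj vec.independent_Basis vec.span_Basis independent_Basis span_Basis by auto
qed

text \<open>The \<open>\<real>\<close>-linear map \<open>f \<otimes> id\<close> on \<open>V \<otimes>\<^sub>\<rat> \<real>\<close>, for a \<open>\<rat>\<close>-linear \<open>f\<close>.\<close>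

definition extend_scalars :: "('v \<Rightarrow> 'w::real_vector) \<Rightarrow> ('v \<Rightarrow> 'v) \<Rightarrow> 'w \<Rightarrow> 'w"
  where "extend_scalars \<iota> f = (THE T. linear T \<and> (\<forall>v. T (\<iota> v) = \<iota> (f v)))"

lemma extend_scalars:
  fixes \<iota> :: "'v::ab_group_add \<Rightarrow> 'w::real_vector"
  assumes "scalar_extension scl \<iota>" "Vector_Spaces.linear scl scl f"
  shows "linear (extend_scalars \<iota> f)" "extend_scalars \<iota> f (\<iota> v) = \<iota> (f v)"
proof -
  have "Vector_Spaces.linear scl scaleQ (\<iota> \<circ> f)"
    using assms by (intro Vector_Spaces.linear_compose) (auto simp: scalar_extension_def)
  from scalar_extension_universal[OF assms(1) this]
  have "\<exists>!T. linear T \<and> (\<forall>v. T (\<iota> v) = \<iota> (f v))" by simp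
  from theI'[OF this] show "linear (extend_scalars \<iota> f)" "extend_scalars \<iota> f (\<iota> v) = \<iota> (f v)"
    unfolding extend_scalars_def by blast+
qed

text \<open>
  \<open>V \<otimes>\<^sub>\<rat> \<real>\<close> is finite-dimensional, so all its endomorphisms are bounded for whatever norm
  it carries, and the operator norm topology on \<open>'w \<Rightarrow>\<^sub>L 'w\<close> is the usual topology of the
  finite-dimensional real vector space \<open>End\<^sub>\<real>(V \<otimes>\<^sub>\<rat> \<real>)\<close>.
\<close>

definition invariant_complex_structures ::
    "('g, 'm) monoid_scheme \<Rightarrow> ('g \<Rightarrow> 'v \<Rightarrow> 'v) \<Rightarrow> ('v \<Rightarrow> 'w::real_normed_vector) \<Rightarrow>
      ('w \<Rightarrow>\<^sub>L 'w) set"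
  where "invariant_complex_structures G \<rho> \<iota> =
    {J. J o\<^sub>L J = - id_blinfun \<and>
        (\<forall>g\<in>carrier G. \<forall>w. J (extend_scalars \<iota> (\<rho> g) w) = extend_scalars \<iota> (\<rho> g) (J w))}"

definition rational_lattice :: "(rat \<Rightarrow> 'v \<Rightarrow> 'v::ab_group_add) \<Rightarrow> 'v set \<Rightarrow> bool"
  where "rational_lattice scl \<Lambda> \<longleftrightarrow>
    (\<exists>S. finite S \<and> \<Lambda> = group_closure S) \<and> module.span scl \<Lambda> = UNIV"

text \<open>
  Symmetry of the form \<open>\<omega>(J\<cdot>, \<cdot>)\<close> is not listed separately: it follows from
  \<open>\<omega>\<close> being alternating and \<open>J\<close>-invariant together with \<open>J\<^sup>2 = -id\<close>.
\<close>

definition polarisable ::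
    "(rat \<Rightarrow> 'v \<Rightarrow> 'v::ab_group_add) \<Rightarrow> ('v \<Rightarrow> 'w::real_normed_vector) \<Rightarrow> ('w \<Rightarrow>\<^sub>L 'w) \<Rightarrow> bool"
  where "polarisable scl \<iota> J \<longleftrightarrow>
    (\<exists>\<omega> :: 'w \<Rightarrow> 'w \<Rightarrow> real.
       bilinear \<omega> \<and> (\<forall>x. \<omega> x x = 0) \<and>
       (\<forall>x y. \<omega> (J x) (J y) = \<omega> x y) \<and>
       (\<forall>x. x \<noteq> 0 \<longrightarrow> \<omega> (J x) x > 0) \<and>
       (\<exists>\<Lambda>. rational_lattice scl \<Lambda> \<and> (\<forall>a\<in>\<Lambda>. \<forall>b\<in>\<Lambda>. \<omega> (\<iota> a) (\<iota> b) \<in> \<int>)))"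

end

theory Submission
  imports Defs
begin

text \<open>
  Averaging an inner product over the group generated by \<open>G\<close> and \<open>J\<close> gives an invariant inner
  product \<open>h\<close>, and \<open>\<omega>(x, y) = h(x, J y)\<close> is a \<open>G\<close>-invariant symplectic form for which \<open>J\<close> is
  compatible and positive; only rationality is missing. Rounding the values of \<open>\<omega>\<close> on a rational
  basis and averaging over \<open>G\<close> yields a rational \<open>G\<close>-invariant form \<open>\<omega>'\<close> as close to \<open>\<omega>\<close> as we
  like. Write \<open>\<omega>'(x, y) = \<omega>((id + X) x, y)\<close> with \<open>X\<close> small, \<open>\<omega>\<close>-selfadjoint and commuting with
  \<open>G\<close>, and let \<open>T = id + Y\<close> be the square root of \<open>id + X\<close> near the identity, which has the same
  two properties. Then \<open>\<omega>'(x, y) = \<omega>(T x, T y)\<close>, so \<open>\<omega>'\<close> polarises \<open>T\<^sup>-\<^sup>1 J T\<close>, which is close to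
  \<open>J\<close> and joined to it by conjugating with \<open>id + t Y\<close>.
\<close>

section \<open>Finite-dimensional normed spaces\<close>

text \<open>Tychonoff's theorem, phrased for the function topology. It makes boxes of coordinate
  vectors compact.\<close>

lemma compact_Pi_UNIV:
  fixes K :: "'a \<Rightarrow> 'b::topological_space set"
  assumes "\<And>i. compact (K i)"
  shows "compact {c. \<forall>i. c i \<in> K i}"
proof -
  have "compactin (product_topology (\<lambda>_. euclidean) UNIV) (PiE UNIV K)"
    using assms by (subst compactin_PiE) auto
  moreover have "PiE UNIV K = {c. \<forall>i. c i \<in> K i}"
    by (auto simp: PiE_UNIV_domain)
  ultimately show ?thesis
    by (simp add: euclidean_product_topology)
qed

text \<open>Bounded coordinates turn a Cauchy sequence into convergent real sequences, and the
  limits of these reassemble to a limit vector. The coordinate system is abstract so that it can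
  later consist of matrix entries.\<close>

lemma complete_UNIV_coordinates:
  fixes \<phi> :: "'i \<Rightarrow> 'a::real_normed_vector \<Rightarrow> real"
  assumes lin: "\<And>i. i \<in> I \<Longrightarrow> bounded_linear (\<phi> i)"
    and sum: "\<And>x. x = (\<Sum>i\<in>I. \<phi> i x *\<^sub>R e i)"
  shows "complete (UNIV :: 'a set)"
proof (rule completeI)
  fix X :: "nat \<Rightarrow> 'a"
  assume X: "Cauchy X"
  have "convergent (\<lambda>n. \<phi> i (X n))" if "i \<in> I" for i
    using bounded_linear.Cauchy[OF lin[OF that] X] Cauchy_convergent by blast
  then obtain l where l: "\<And>i. i \<in> I \<Longrightarrow> (\<lambda>n. \<phi> i (X n)) \<longlonglongrightarrow> l i"
    unfolding convergent_def by metis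
  have "(\<lambda>n. \<Sum>i\<in>I. \<phi> i (X n) *\<^sub>R e i) \<longlonglongrightarrow> (\<Sum>i\<in>I. l i *\<^sub>R e i)"
    by (intro tendsto_sum tendsto_scaleR l tendsto_const)
  then show "\<exists>l\<in>UNIV. X \<longlonglongrightarrow> l"
    using sum by auto
qed

text \<open>The type \<open>'w\<close> carries an arbitrary norm and no finiteness of its own, so
  finite-dimensionality enters through a basis, from which boundedness and completeness are
  derived.\<close>

locale finite_real_basis =
  fixes B :: "'w::real_normed_vector set"
  assumes finite_basis: "finite B"
    and independent_basis: "independent B"
    and span_basis: "span B = UNIV"
begin

sublocale W: finite_dimensional_vector_space scaleR B
  using finite_basis independent_basis span_basis
  by unfold_locales (simp_all add: dependent_raw_def span_raw_def)

definition coord :: "'w \<Rightarrow> 'w \<Rightarrow> real"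
  where "coord b x = representation B x b"

lemma sum_coord: "(\<Sum>b\<in>B. coord b x *\<^sub>R b) = x"
  unfolding coord_def
  by (rule real_vector.sum_representation_eq)
     (use finite_basis independent_basis span_basis in auto)

lemma linear_coord: "linear (coord b)"
  unfolding coord_def
  by (rule linearI)
     (use independent_basis span_basis in
       \<open>simp_all add: real_vector.representation_add real_vector.representation_scale\<close>)

lemma coord_basis: "b' \<in> B \<Longrightarrow> coord b b' = (if b = b' then 1 else 0)"
  using independent_basis by (simp add: coord_def real_vector.representation_basis)

lemma coord_sum: "b \<in> B \<Longrightarrow> coord b (\<Sum>b'\<in>B. c b' *\<^sub>R b') = c b"
proof -
  assume b: "b \<in> B"
  have "coord b (\<Sum>b'\<in>B. c b' *\<^sub>R b') = (\<Sum>b'\<in>B. if b = b' then c b' else 0)"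
    unfolding linear_sum[OF linear_coord] linear_scale[OF linear_coord]
    by (rule sum.cong) (simp_all add: coord_basis)
  then show ?thesis using b finite_basis by simp
qed

text \<open>On the compact set of coordinate vectors with entry \<open>1\<close> at \<open>b\<close> and all other entries in
  \<open>[-1, 1]\<close> the norm is bounded below; scaling by the largest coordinate reduces to this case.\<close>
lemma norm_lower_bound:
  "\<exists>m>0. \<forall>x. (\<forall>b'\<in>B. \<bar>coord b' x\<bar> \<le> \<bar>coord b x\<bar>) \<longrightarrow> m * \<bar>coord b x\<bar> \<le> norm x"
  if b: "b \<in> B"
proof -
  define K where "K i = (if i = b then {1} else {-1..1::real})" for i
  define F where "F c = (\<Sum>i\<in>B. c i *\<^sub>R i)" for c :: "'w \<Rightarrow> real"
  have "compact {c. \<forall>i. c i \<in> K i}"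
    by (rule compact_Pi_UNIV) (simp add: K_def)
  moreover have "continuous_on {c. \<forall>i. c i \<in> K i} F"
    unfolding F_def
    by (intro continuous_intros continuous_on_subset[OF continuous_on_product_coordinates]) auto
  ultimately have "compact (F ` {c. \<forall>i. c i \<in> K i})"
    using compact_continuous_image by blast
  moreover have "0 \<notin> F ` {c. \<forall>i. c i \<in> K i}"
  proof
    assume "0 \<in> F ` {c. \<forall>i. c i \<in> K i}"
    then obtain c where c: "F c = 0" "\<forall>i. c i \<in> K i" by auto
    have "c b = 0" using coord_sum[OF b, of c] c(1) linear_0[OF linear_coord] by (simp add: F_def)
    moreover have "c b \<in> K b" using c(2) by blast
    ultimately show False by (simp add: K_def)
  qed
  ultimately have "open (- (F ` {c. \<forall>i. c i \<in> K i}))" "0 \<in> - F ` {c. \<forall>i. c i \<in> K i}"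
    by (auto intro: compact_imp_closed)
  then obtain m where m: "m > 0" "ball 0 m \<subseteq> - F ` {c. \<forall>i. c i \<in> K i}"
    by (rule openE)
  have "m * \<bar>coord b x\<bar> \<le> norm x" if le: "\<forall>b'\<in>B. \<bar>coord b' x\<bar> \<le> \<bar>coord b x\<bar>" for x
  proof (cases "coord b x = 0")
    case False
    \<comment> \<open>The box is a product over the whole type, so entries outside \<open>B\<close>
      need some value in [-1, 1]; the default 0 provides it, and \<open>F\<close> ignores
      it.\<close>
    define c where "c i = (if i \<in> B then coord i x / coord b x else 0)" for i
    have "c i \<in> K i" for i
    proof -
      have "\<bar>coord i x / coord b x\<bar> \<le> 1" if "i \<in> B"
        using le that False by (simp add: abs_divide divide_le_eq_1)
      then have "coord i x / coord b x \<in> {-1..1}" if "i \<in> B"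
        using that by (simp only: abs_le_iff atLeastAtMost_iff minus_le_iff)
      then show ?thesis using False b by (simp add: c_def K_def)
    qed
    then have "F c \<notin> ball 0 m" using m(2) by blast
    then have "m \<le> dist 0 (F c)" by simp
    also have "F c = (1 / coord b x) *\<^sub>R (\<Sum>i\<in>B. coord i x *\<^sub>R i)"
      unfolding F_def scaleR_sum_right by (rule sum.cong) (auto simp: c_def)
    also have "dist 0 \<dots> = norm x / \<bar>coord b x\<bar>"
      by (simp add: sum_coord)
    finally show ?thesis using False by (simp add: field_simps)
  qed simp
  with m(1) show ?thesis by meson
qed

text \<open>The lower bound on the norm applies only to the index of the largest coordinate, which
  varies with \<open>x\<close>. Summing the reciprocals of all the constants gives one bound that
  covers every case.\<close>

lemma bounded_linear_coord:
  assumes b: "b \<in> B"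
  shows "bounded_linear (coord b)"
proof -
  obtain m where m: "\<forall>b\<in>B. m b > 0 \<and>
      (\<forall>x. (\<forall>b'\<in>B. \<bar>coord b' x\<bar> \<le> \<bar>coord b x\<bar>) \<longrightarrow> m b * \<bar>coord b x\<bar> \<le> norm x)"
    using bchoice[of B "\<lambda>b m. m > 0 \<and>
      (\<forall>x. (\<forall>b'\<in>B. \<bar>coord b' x\<bar> \<le> \<bar>coord b x\<bar>) \<longrightarrow> m * \<bar>coord b x\<bar> \<le> norm x)"] norm_lower_bound
    by blast
  have "\<bar>coord b x\<bar> \<le> norm x * (\<Sum>i\<in>B. 1 / m i)" for x
  proof -
    have "finite ((\<lambda>i. \<bar>coord i x\<bar>) ` B)" "(\<lambda>i. \<bar>coord i x\<bar>) ` B \<noteq> {}"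
      using finite_basis b by auto
    then have "Max ((\<lambda>i. \<bar>coord i x\<bar>) ` B) \<in> (\<lambda>i. \<bar>coord i x\<bar>) ` B"
      by (rule Max_in)
    then obtain k where k: "k \<in> B" "Max ((\<lambda>i. \<bar>coord i x\<bar>) ` B) = \<bar>coord k x\<bar>"
      by (rule imageE)
    have le: "\<bar>coord i x\<bar> \<le> \<bar>coord k x\<bar>" if "i \<in> B" for i
      unfolding k(2)[symmetric] by (rule Max_ge) (use finite_basis that in auto)
    have "\<bar>coord b x\<bar> \<le> \<bar>coord k x\<bar>" using le b by simp
    also have "\<dots> \<le> norm x * (1 / m k)"
      using bspec[OF m k(1)] le by (simp add: field_simps)
    also have "\<dots> \<le> norm x * (\<Sum>i\<in>B. 1 / m i)"
      using m k(1) finite_basis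
      by (intro mult_left_mono member_le_sum) (auto simp: less_imp_le)
    finally show ?thesis .
  qed
  then show ?thesis
    using linear_coord by (intro bounded_linear_intro[where K = "\<Sum>i\<in>B. 1 / m i"])
      (auto simp: linear_add linear_scale)
qed

lemma linear_imp_bounded_linear:
  fixes f :: "'w \<Rightarrow> 'u::real_normed_vector"
  assumes f: "linear f"
  shows "bounded_linear f"
proof -
  have "f (\<Sum>b\<in>B. coord b x *\<^sub>R b) = (\<Sum>b\<in>B. coord b x *\<^sub>R f b)" for x
    unfolding linear_sum[OF f] linear_scale[OF f] ..
  then have "(\<Sum>b\<in>B. coord b x *\<^sub>R f b) = f x" for x
    unfolding sum_coord ..
  moreover have "bounded_linear (\<lambda>x. \<Sum>b\<in>B. coord b x *\<^sub>R f b)"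
    by (intro bounded_linear_sum bounded_linear_compose[OF bounded_linear_scaleR_left]
        bounded_linear_coord)
  ultimately show ?thesis by simp
qed

text \<open>Matrix entries serve as coordinates and the elementary matrices \<open>?E p\<close>,
  sending \<open>snd p\<close> to \<open>fst p\<close>, as basis. Completeness is what Banach's
  fixed point theorem asks for below.\<close>

lemma complete_endomorphisms: "complete (UNIV :: ('w \<Rightarrow>\<^sub>L 'w) set)"
proof (rule complete_UNIV_coordinates)
  fix p assume "p \<in> B \<times> B"
  then show "bounded_linear (\<lambda>Y::'w \<Rightarrow>\<^sub>L 'w. coord (fst p) (Y (snd p)))"
    by (intro bounded_linear_compose[OF bounded_linear_coord] bounded_linear_intros) auto
next
  fix Y :: "'w \<Rightarrow>\<^sub>L 'w"
  let ?E = "\<lambda>p. Blinfun (\<lambda>x. coord (snd p) x *\<^sub>R fst p)"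
  have E: "?E p x = coord (snd p) x *\<^sub>R fst p" if "p \<in> B \<times> B" for p x
    using that by (subst bounded_linear_Blinfun_apply)
      (auto intro!: bounded_linear_compose[OF bounded_linear_scaleR_left] bounded_linear_coord)
  show "Y = (\<Sum>p\<in>B\<times>B. coord (fst p) (Y (snd p)) *\<^sub>R ?E p)"
  proof (rule blinfun_eqI)
    fix x
    have "blinfun_apply (\<Sum>p\<in>B\<times>B. coord (fst p) (Y (snd p)) *\<^sub>R ?E p) x =
        (\<Sum>p\<in>B\<times>B. coord (fst p) (Y (snd p)) *\<^sub>R (coord (snd p) x *\<^sub>R fst p))"
      unfolding blinfun.sum_left
      by (rule sum.cong) (use E in \<open>auto simp: blinfun.scaleR_left\<close>)
    also have "\<dots> = (\<Sum>c\<in>B. \<Sum>b\<in>B. coord b (Y c) *\<^sub>R coord c x *\<^sub>R b)"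
      by (subst sum.swap) (simp add: sum.cartesian_product case_prod_beta)
    also have "\<dots> = (\<Sum>c\<in>B. coord c x *\<^sub>R (\<Sum>b\<in>B. coord b (Y c) *\<^sub>R b))"
      by (simp add: scaleR_sum_right mult.commute)
    also have "\<dots> = (\<Sum>c\<in>B. coord c x *\<^sub>R Y c)"
      by (simp only: sum_coord)
    also have "\<dots> = Y (\<Sum>c\<in>B. coord c x *\<^sub>R c)"
      by (simp only: blinfun.sum_right blinfun.scaleR_right)
    also have "\<dots> = Y x" by (simp add: sum_coord)
    finally show "Y x = blinfun_apply (\<Sum>p\<in>B\<times>B. coord (fst p) (Y (snd p)) *\<^sub>R ?E p) x" ..
  qed
qed

section \<open>Endomorphisms near the identity\<close>

text \<open>A right inverse of \<open>id + Z\<close> is a fixed point of the contraction sending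
  \<open>S\<close> to \<open>id - Z S\<close>. The estimate \<open>low\<close> makes
  \<open>id + Z\<close> injective, so the right inverse is also a left inverse, and it bounds the
  norm of \<open>S\<close> as well.\<close>

lemma inverse_near_identity:
  fixes Z :: "'w \<Rightarrow>\<^sub>L 'w"
  assumes Z: "norm Z \<le> r" and r: "r < 1"
  obtains S :: "'w \<Rightarrow>\<^sub>L 'w"
  where "norm S \<le> 1 / (1 - r)" "\<forall>x. S x + Z (S x) = x" "\<forall>x. S (x + Z x) = x"
proof -
  have r0: "0 \<le> r" using Z norm_ge_zero order_trans by blast
  have "\<exists>!S\<in>UNIV. id_blinfun - (Z o\<^sub>L S) = S"
  proof (rule Banach_fix[OF complete_endomorphisms UNIV_not_empty r0 r subset_UNIV])
    fix S T :: "'w \<Rightarrow>\<^sub>L 'w"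
    have "dist (id_blinfun - (Z o\<^sub>L S)) (id_blinfun - (Z o\<^sub>L T)) = norm (Z o\<^sub>L (T - S))"
      by (simp add: dist_norm bounded_bilinear.diff_right[OF bounded_bilinear_blinfun_compose])
    also have "\<dots> \<le> norm Z * norm (T - S)" by (rule norm_blinfun_compose)
    also have "\<dots> \<le> r * norm (T - S)" by (intro mult_right_mono Z norm_ge_zero)
    finally show "dist (id_blinfun - (Z o\<^sub>L S)) (id_blinfun - (Z o\<^sub>L T)) \<le> r * dist S T"
      by (simp add: dist_norm norm_minus_commute)
  qed
  then obtain S where S: "id_blinfun - (Z o\<^sub>L S) = S" by blast
  have 1: "S x + Z (S x) = x" for x
    using arg_cong[OF S, of "\<lambda>f. blinfun_apply f x"]
    by (simp add: blinfun.diff_left algebra_simps)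
  have low: "(1 - r) * norm x \<le> norm (x + Z x)" for x
  proof -
    have "norm (Z x) \<le> r * norm x"
      using norm_blinfun[of Z x] mult_right_mono[OF Z norm_ge_zero[of x]] by linarith
    then show ?thesis
      using norm_diff_ineq[of x "Z x"] by (simp add: algebra_simps)
  qed
  have 2: "S (x + Z x) = x" for x
  proof -
    \<comment> \<open>The defect of \<open>S\<close> as a left inverse is killed by
      \<open>id + Z\<close>.\<close>
    let ?d = "S (x + Z x) - x"
    have "?d + Z ?d = 0"
      using 1[of "x + Z x"] by (simp add: blinfun.diff_right algebra_simps)
    then have "(1 - r) * norm ?d \<le> 0" using low[of ?d] by simp
    then have "norm ?d = 0" using r by (simp add: mult_le_0_iff)
    then show ?thesis by simp
  qed
  have "norm S \<le> 1 / (1 - r)"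
  proof (rule norm_blinfun_bound)
    fix x
    show "norm (S x) \<le> 1 / (1 - r) * norm x"
      using low[of "S x"] r 1[of x] by (simp add: field_simps)
  qed (use r in simp)
  with 1 2 show ?thesis by (intro that allI)
qed

text \<open>The equation says \<open>(id + Y)\<^sup>2 = id + X\<close>; iterating it produces a square root inside any
  closed set of endomorphisms that the iteration preserves.\<close>
lemma square_root_near_identity:
  fixes X :: "'w \<Rightarrow>\<^sub>L 'w"
  assumes X: "norm X \<le> r" and r: "r \<le> 1/2"
    and C: "closed C" "0 \<in> C"
    and step: "\<And>Y. Y \<in> C \<Longrightarrow> (1/2) *\<^sub>R (X - (Y o\<^sub>L Y)) \<in> C"
  obtains Y where "Y \<in> C" "norm Y \<le> r" "\<And>x. 2 *\<^sub>R Y x + Y (Y x) = X x"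
proof -
  define f where "f Y = (1/2) *\<^sub>R (X - (Y o\<^sub>L Y))" for Y :: "'w \<Rightarrow>\<^sub>L 'w"
  have r0: "0 \<le> r" using X norm_ge_zero order_trans by blast
  have "complete (UNIV \<inter> (C \<inter> cball 0 r))"
    by (intro complete_Int_closed complete_endomorphisms closed_Int C closed_cball)
  moreover have "C \<inter> cball 0 r \<noteq> {}" using C r0 by auto
  moreover have "f ` (C \<inter> cball 0 r) \<subseteq> C \<inter> cball 0 r"
  proof (rule image_subsetI)
    fix Y assume Y: "Y \<in> C \<inter> cball 0 r"
    have "norm (X - (Y o\<^sub>L Y)) \<le> norm X + norm (Y o\<^sub>L Y)" by (rule norm_triangle_ineq4)
    also have "\<dots> \<le> norm X + norm Y * norm Y" by (simp add: norm_blinfun_compose)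
    \<comment> \<open>One factor \<open>norm Y\<close> is bounded by \<open>r\<close> and the other
      by 1/2. Halving the sum gives 3r/4, so the ball of radius \<open>r\<close> is
      preserved.\<close>
    also have "\<dots> \<le> r + r * (1/2)"
      using X Y r r0 by (intro add_mono mult_mono) auto
    finally have "norm (f Y) \<le> r" using r0 by (simp add: f_def)
    then show "f Y \<in> C \<inter> cball 0 r" using step Y by (simp add: f_def)
  qed
  moreover have "dist (f Y) (f Z) \<le> 1/2 * dist Y Z"
    if "Y \<in> C \<inter> cball 0 r" "Z \<in> C \<inter> cball 0 r" for Y Z
  proof -
    have n: "norm Y \<le> 1/2" "norm Z \<le> 1/2" using that r by auto
    \<comment> \<open>A difference of squares without commutativity. With both norms at most 1/2,
      the Lipschitz constant is 1/2.\<close>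
    have "f Y - f Z = (1/2) *\<^sub>R ((Y o\<^sub>L (Z - Y)) + ((Z - Y) o\<^sub>L Z))"
      by (rule blinfun_eqI)
         (simp add: f_def blinfun.diff_left blinfun.diff_right blinfun.add_left blinfun.scaleR_left
           scaleR_diff_right scaleR_add_right)
    then have "norm (f Y - f Z) \<le> 1/2 * (norm (Y o\<^sub>L (Z - Y)) + norm ((Z - Y) o\<^sub>L Z))"
      by (simp add: norm_triangle_ineq)
    also have "\<dots> \<le> 1/2 * (norm Y * norm (Z - Y) + norm (Z - Y) * norm Z)"
      by (intro mult_left_mono add_mono norm_blinfun_compose) auto
    also have "\<dots> \<le> 1/2 * (1/2 * norm (Z - Y) + norm (Z - Y) * (1/2))"
      by (intro mult_left_mono add_mono mult_right_mono n) auto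
    finally show ?thesis by (simp add: dist_norm norm_minus_commute)
  qed
  ultimately have "\<exists>!Y\<in>C \<inter> cball 0 r. f Y = Y"
    using Banach_fix[of "C \<inter> cball 0 r" "1/2" f] by simp
  then obtain Y where Y: "Y \<in> C" "norm Y \<le> r" "f Y = Y" by auto
  have "2 *\<^sub>R Y x + Y (Y x) = X x" for x
  proof -
    have "2 *\<^sub>R Y x = 2 *\<^sub>R f Y x" using Y(3) by simp
    also have "\<dots> = X x - Y (Y x)"
      by (simp add: f_def blinfun.diff_left blinfun.scaleR_left)
    finally show ?thesis by (simp add: algebra_simps)
  qed
  with Y show ?thesis by (intro that)
qed

text \<open>The bound \<delta> precedes \<eta> because it depends only on \<omega> and
  \<open>r\<close>; a rational form within \<delta> can then be chosen afterwards. No group occurs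
  here: the root commutes with every surjective common isometry \<open>E\<close> of both forms, and
  group elements are inserted for \<open>E\<close> later.\<close>

lemma alternating_perturbation:
  fixes \<omega> :: "'w \<Rightarrow> 'w \<Rightarrow> real"
  assumes bil: "bilinear \<omega>" and alt: "\<And>x. \<omega> x x = 0"
    and nondeg: "\<And>x. (\<And>y. \<omega> x y = 0) \<Longrightarrow> x = 0"
    and r: "0 < r" "r \<le> 1/2"
  obtains \<delta> where "\<delta> > 0"
    and "\<forall>\<eta>. bilinear \<eta> \<longrightarrow> (\<forall>x. \<eta> x x = 0) \<longrightarrow> (\<forall>x y. \<bar>\<eta> x y\<bar> \<le> \<delta> * norm x * norm y) \<longrightarrow>
      (\<exists>Y. norm Y \<le> r \<and>
        (\<forall>x y. \<omega> (x + blinfun_apply Y x) (y + blinfun_apply Y y) = \<omega> x y + \<eta> x y) \<and>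
        (\<forall>E. linear E \<longrightarrow> surj E \<longrightarrow> (\<forall>x y. \<omega> (E x) (E y) = \<omega> x y) \<longrightarrow>
          (\<forall>x y. \<eta> (E x) (E y) = \<eta> x y) \<longrightarrow> (\<forall>x. blinfun_apply Y (E x) = E (blinfun_apply Y x))))"
proof -
  have linl: "linear (\<lambda>x. f x y)" if "bilinear f" for f :: "'w \<Rightarrow> 'w \<Rightarrow> real" and y
    using that by (simp add: bilinear_def)
  have linr: "linear (f x)" if "bilinear f" for f :: "'w \<Rightarrow> 'w \<Rightarrow> real" and x
    using that by (simp add: bilinear_def)
  have skew: "f x y = - f y x" if f: "bilinear f" "\<And>x. f x x = 0" for f :: "'w \<Rightarrow> 'w \<Rightarrow> real" and x y
    using f(2)[of "x + y"] f(2)[of x] f(2)[of y]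
    by (simp add: bilinear_ladd[OF f(1)] bilinear_radd[OF f(1)])
  have lin_sharp: "linear (\<lambda>x. \<Sum>b\<in>B. f x b *\<^sub>R b)" if f: "bilinear f" for f
    by (rule linearI) (simp_all add: bilinear_ladd[OF f] bilinear_lmul[OF f]
        scaleR_add_left sum.distrib scaleR_sum_right)
  \<comment> \<open>This is the map from \<open>x\<close> to the functional \<omega>(x, -), turned
    into an endomorphism by using the values on \<open>B\<close> as coordinates. Nondegeneracy makes
    it injective, hence bijective, and \<open>L\<close> inverts it.\<close>
  define \<Omega> where "\<Omega> x = (\<Sum>b\<in>B. \<omega> x b *\<^sub>R b)" for x
  have \<Omega>: "linear \<Omega>" unfolding \<Omega>_def by (rule lin_sharp[OF bil])
  have eqB: "f y = g y" if "linear f" "linear g" "\<And>b. b \<in> B \<Longrightarrow> f b = g b" for f g :: "'w \<Rightarrow> real" and y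
    by (rule linear_eq_on[OF that(1,2), of y B]) (use that(3) span_basis in auto)
  have "x = 0" if "\<Omega> x = 0" for x
  proof (rule nondeg)
    fix y
    have "\<omega> x b = 0" if b: "b \<in> B" for b
      using coord_sum[OF b, of "\<omega> x"] \<open>\<Omega> x = 0\<close> linear_0[OF linear_coord] by (simp add: \<Omega>_def)
    then show "\<omega> x y = 0"
      by (rule eqB[OF linr[OF bil] linear_zero])
  qed
  then have "inj \<Omega>" using linear_injective_0[OF \<Omega>] by blast
  then have "surj \<Omega>" using W.linear_inj_imp_surj \<Omega> by (simp add: linear_def)
  then obtain L where L: "linear L" "\<Omega> \<circ> L = id"
    using linear_surjective_right_inverse[OF \<Omega>] by blast
  obtain K where K: "K > 0" "\<And>x. norm (L x) \<le> norm x * K"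
    using bounded_linear.pos_bounded[OF linear_imp_bounded_linear[OF L(1)]] by blast
  \<comment> \<open>Reading \<eta>(x, -) as a vector costs a factor \<open>N\<close>, and applying
    \<open>L\<close> costs \<open>K\<close>; \<delta> is chosen so that \<delta> K N = r. The
    summand 1 keeps \<open>N\<close> positive in dimension zero.\<close>
  define N where "N = 1 + (\<Sum>b\<in>B. norm b * norm b)"
  have N: "N > 0" unfolding N_def by (intro add_pos_nonneg sum_nonneg) auto
  define \<delta> where "\<delta> = r / (K * N)"
  show ?thesis
  proof (rule that[of \<delta>], goal_cases)
    case 1
    show ?case using r K N by (simp add: \<delta>_def)
  next
    case 2
    show ?case
    proof (intro allI impI)
      fix \<eta> :: "'w \<Rightarrow> 'w \<Rightarrow> real"
      assume "bilinear \<eta>" and "\<forall>x. \<eta> x x = 0"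
        and "\<forall>x y. \<bar>\<eta> x y\<bar> \<le> \<delta> * norm x * norm y"
      then have \<eta>: "bilinear \<eta>" "\<eta> x x = 0" and small: "\<bar>\<eta> x y\<bar> \<le> \<delta> * norm x * norm y" for x y
        by auto
      define X0 where "X0 x = L (\<Sum>b\<in>B. \<eta> x b *\<^sub>R b)" for x
      have "linear X0"
        unfolding X0_def using linear_compose[OF lin_sharp[OF \<eta>(1)] L(1)] by (simp add: o_def)
      define X where "X = Blinfun X0"
      have X: "blinfun_apply X = X0"
        unfolding X_def by (intro bounded_linear_Blinfun_apply linear_imp_bounded_linear) fact
      have \<omega>X: "\<omega> (X x) y = \<eta> x y" for x y
      proof (rule eqB[OF linr[OF bil] linr[OF \<eta>(1)]])
        fix b assume b: "b \<in> B"
        have "\<Omega> (X0 x) = (\<Sum>b\<in>B. \<eta> x b *\<^sub>R b)"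
          unfolding X0_def using L(2) by (simp add: o_def fun_eq_iff)
        then show "\<omega> (X x) b = \<eta> x b"
          using coord_sum[OF b] unfolding \<Omega>_def X by metis
      qed
      have "norm X \<le> r"
      proof (rule norm_blinfun_bound)
        fix x
        have "norm (\<Sum>b\<in>B. \<eta> x b *\<^sub>R b) \<le> (\<Sum>b\<in>B. \<delta> * norm x * (norm b * norm b))"
          by (rule sum_norm_le) (use small mult_right_mono[OF small norm_ge_zero] in
              \<open>simp add: mult.assoc\<close>)
        also have "\<dots> \<le> \<delta> * norm x * N"
          using r K N unfolding sum_distrib_left[symmetric] N_def \<delta>_def
          by (intro mult_left_mono) auto
        finally have "norm (X x) \<le> \<delta> * norm x * N * K"
          unfolding X X0_def using K order_trans mult_right_mono less_imp_le by metis
        then show "norm (X x) \<le> r * norm x" using K N by (simp add: \<delta>_def)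
      qed (use r in simp)
      \<comment> \<open>The set \<open>C\<close> collects the properties wanted of the root:
        commuting with all common isometries and being \<omega>-selfadjoint. Both are closed
        conditions that sums, scalar multiples and the square of one element preserve, so the
        iteration stays in \<open>C\<close>.\<close>
      define EE where "EE = {E. linear E \<and> surj E \<and> (\<forall>x y. \<omega> (E x) (E y) = \<omega> x y) \<and>
        (\<forall>x y. \<eta> (E x) (E y) = \<eta> x y)}"
      define C where "C = {Y. (\<forall>E x. E \<in> EE \<longrightarrow> blinfun_apply Y (E x) = E (blinfun_apply Y x)) \<and>
        (\<forall>x y. \<omega> (blinfun_apply Y x) y = \<omega> x (blinfun_apply Y y))}"
      have closed: "closed C"
        unfolding C_def
      proof (intro closed_Collect_conj closed_Collect_all)
        fix E x
        show "closed {Y. E \<in> EE \<longrightarrow> blinfun_apply Y (E x) = E (blinfun_apply Y x)}"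
        proof (cases "E \<in> EE")
          case True
          then have E: "bounded_linear E" by (simp add: EE_def linear_imp_bounded_linear)
          have "closed {Y. blinfun_apply Y (E x) = E (blinfun_apply Y x)}"
            by (intro closed_Collect_eq continuous_intros bounded_linear.continuous_on[OF E])
          then show ?thesis using True by simp
        qed simp
      next
        fix x y
        show "closed {Y. \<omega> (blinfun_apply Y x) y = \<omega> x (blinfun_apply Y y)}"
          by (intro closed_Collect_eq continuous_intros
              bounded_linear.continuous_on[OF linear_imp_bounded_linear[OF linl[OF bil]]]
              bounded_linear.continuous_on[OF linear_imp_bounded_linear[OF linr[OF bil]]])
      qed
      have zero: "0 \<in> C"
        by (auto simp: C_def EE_def bilinear_lzero[OF bil] bilinear_rzero[OF bil] linear_0)
      have "X \<in> C"
        unfolding C_def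
      proof (intro CollectI conjI allI impI)
        fix E x assume E: "E \<in> EE"
        have "X (E x) - E (X x) = 0"
        proof (rule nondeg)
          fix y
          \<comment> \<open>By surjectivity of \<open>E\<close>, nondegeneracy may be tested on
            vectors \<open>E z\<close> alone, where invariance of both forms applies.\<close>
          obtain z where z: "y = E z" using E unfolding EE_def by (metis (mono_tags, lifting) mem_Collect_eq surjD)
          have "\<omega> (X (E x)) (E z) = \<omega> (E (X x)) (E z)"
            using E by (simp add: \<omega>X EE_def)
          then show "\<omega> (X (E x) - E (X x)) y = 0" by (simp add: z bilinear_lsub[OF bil])
        qed
        then show "X (E x) = E (X x)" by simp
      next
        fix x y
        show "\<omega> (X x) y = \<omega> x (X y)"
          \<comment> \<open>One sign comes from \<eta>, one from \<omega>, and they cancel.\<close>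
          using skew[OF \<eta>, of x y] skew[OF bil alt, of x "X y"] by (simp add: \<omega>X)
      qed
      then have step: "(1/2) *\<^sub>R (X - (Y o\<^sub>L Y)) \<in> C" if "Y \<in> C" for Y
        using that by (auto simp: C_def EE_def blinfun.diff_left blinfun.scaleR_left linear_diff
            linear_scale bilinear_lmul[OF bil] bilinear_rmul[OF bil]
            bilinear_lsub[OF bil] bilinear_rsub[OF bil])
      obtain Y where Y: "Y \<in> C" "norm Y \<le> r" "\<And>x. 2 *\<^sub>R Y x + Y (Y x) = X x"
        using square_root_near_identity[OF \<open>norm X \<le> r\<close> r(2) closed zero step] by blast
      have "\<omega> (x + Y x) (y + Y y) = \<omega> x y + \<eta> x y" for x y
      proof -
        \<comment> \<open>Moving every \<open>Y\<close> to the first argument turns the cross terms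
          into 2Y + Y^2, which equals \<open>X\<close>.\<close>
        have sa: "\<omega> u (Y v) = \<omega> (Y u) v" for u v using Y(1) by (simp add: C_def)
        have "\<omega> (x + Y x) (y + Y y) = \<omega> x y + \<omega> (2 *\<^sub>R Y x + Y (Y x)) y"
          by (simp add: bilinear_ladd[OF bil] bilinear_radd[OF bil] bilinear_lmul[OF bil] sa blinfun.add_right)
        then show ?thesis by (simp only: Y(3) \<omega>X)
      qed
      moreover have "\<forall>E. linear E \<longrightarrow> surj E \<longrightarrow> (\<forall>x y. \<omega> (E x) (E y) = \<omega> x y) \<longrightarrow>
          (\<forall>x y. \<eta> (E x) (E y) = \<eta> x y) \<longrightarrow> (\<forall>x. Y (E x) = E (Y x))"
        using Y(1) by (simp add: C_def EE_def)
      ultimately show "\<exists>Y. norm Y \<le> r \<and>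
          (\<forall>x y. \<omega> (x + blinfun_apply Y x) (y + blinfun_apply Y y) = \<omega> x y + \<eta> x y) \<and>
          (\<forall>E. linear E \<longrightarrow> surj E \<longrightarrow> (\<forall>x y. \<omega> (E x) (E y) = \<omega> x y) \<longrightarrow>
            (\<forall>x y. \<eta> (E x) (E y) = \<eta> x y) \<longrightarrow> (\<forall>x. blinfun_apply Y (E x) = E (blinfun_apply Y x)))"
        using Y(2) by blast
    qed
  qed
qed

end

section \<open>Invariant forms\<close>

lemma finite_rationals_common_denominator:
  fixes A :: "real set"
  assumes "finite A" "A \<subseteq> \<rat>"
  shows "\<exists>D::nat. D > 0 \<and> (\<forall>q\<in>A. real D * q \<in> \<int>)"
  using assms
proof induction
  case (insert q A)
  then obtain D where D: "D > 0" "\<And>p. p \<in> A \<Longrightarrow> real D * p \<in> \<int>" by auto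
  from insert.prems have "q \<in> \<rat>" by simp
  then obtain m n where q: "n > 0" "q = real_of_int m / real_of_int n"
    by (auto elim: Rats_cases')
  have "real (D * nat n) * p \<in> \<int>" if "p \<in> insert q A" for p
  proof (cases "p = q")
    case True
    then have "real (D * nat n) * p = real_of_int (int D * m)" using q by simp
    then show ?thesis by (metis Ints_of_int)
  next
    case False
    then have "of_int n * (real D * p) \<in> \<int>" using False D(2)[of p] that by (intro Ints_mult[OF Ints_of_int]) auto
    then show ?thesis using q by (simp add: mult_ac)
  qed
  then show ?case using D(1) q(1) by (intro exI[of _ "D * nat n"]) auto
qed auto

text \<open>Controls how an approximation error grows when both arguments are moved by a group
  element.\<close>

lemma bilinear_bounded_linear_bound:
  fixes E :: "'a::real_normed_vector \<Rightarrow> 'b::real_normed_vector"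
  assumes E: "bounded_linear E"
    and f: "\<And>x y. \<bar>f x y\<bar> \<le> e * norm x * norm y" and e: "0 \<le> e"
  shows "\<bar>f (E x) (E y)\<bar> \<le> e * (onorm E)\<^sup>2 * norm x * norm y"
proof -
  have "\<bar>f (E x) (E y)\<bar> \<le> e * (norm (E x) * norm (E y))" using f by (simp add: mult.assoc)
  also have "\<dots> \<le> e * ((onorm E * norm x) * (onorm E * norm y))"
    by (intro mult_left_mono mult_mono onorm[OF E] e mult_nonneg_nonneg onorm_pos_le[OF E] norm_ge_zero)
  finally show ?thesis by (simp add: power2_eq_square mult_ac)
qed

context finite_real_basis
begin

lemma sum_abs_coord_le:
  obtains K where "K > 0" "\<And>x. (\<Sum>b\<in>B. \<bar>coord b x\<bar>) \<le> K * norm x"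
proof
  have "(\<Sum>b\<in>B. \<bar>coord b x\<bar>) \<le> (\<Sum>b\<in>B. onorm (coord b)) * norm x" for x
    unfolding sum_distrib_right using onorm[OF bounded_linear_coord] by (intro sum_mono) force
  also have "\<dots> x \<le> (1 + (\<Sum>b\<in>B. onorm (coord b))) * norm x" for x
    by (intro mult_right_mono) auto
  finally show "(\<Sum>b\<in>B. \<bar>coord b x\<bar>) \<le> (1 + (\<Sum>b\<in>B. onorm (coord b))) * norm x" for x .
  \<comment> \<open>The constant is divided by later, so the summand 1 guards against dimension
    zero.\<close>
  show "1 + (\<Sum>b\<in>B. onorm (coord b)) > 0"
    by (intro add_pos_nonneg sum_nonneg onorm_pos_le bounded_linear_coord) auto
qed

lemma bilinear_coord_expansion:
  fixes f :: "'w \<Rightarrow> 'w \<Rightarrow> real"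
  assumes f: "bilinear f"
  shows "f x y = (\<Sum>b\<in>B. \<Sum>c\<in>B. coord b x * coord c y * f b c)"
proof -
  have "f x y = f (\<Sum>b\<in>B. coord b x *\<^sub>R b) (\<Sum>c\<in>B. coord c y *\<^sub>R c)"
    by (simp only: sum_coord)
  also have "\<dots> = (\<Sum>b\<in>B. \<Sum>c\<in>B. f (coord b x *\<^sub>R b) (coord c y *\<^sub>R c))"
    by (simp only: bilinear_sum[OF f] sum.cartesian_product)
  finally show ?thesis by (simp add: bilinear_lmul[OF f] bilinear_rmul[OF f] mult_ac)
qed

lemma bilinear_coord_sum:
  "bilinear (\<lambda>x y. \<Sum>b\<in>B. \<Sum>c\<in>B. coord b x * coord c y * (q b c :: real))"
  unfolding bilinear_def
  by (auto intro!: linearI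
      simp: linear_add[OF linear_coord] linear_scale[OF linear_coord] algebra_simps sum.distrib
        sum_distrib_left)

text \<open>Round the Gram matrix entry by entry, antisymmetrise it, and extend bilinearly.\<close>

lemma rational_alternating_approx:
  fixes \<omega> :: "'w \<Rightarrow> 'w \<Rightarrow> real"
  assumes \<omega>: "bilinear \<omega>" "\<And>x. \<omega> x x = 0" and e: "e > 0"
  obtains \<omega>' where "bilinear \<omega>'" "\<And>x. \<omega>' x x = (0::real)"
    "\<And>b c. b \<in> B \<Longrightarrow> c \<in> B \<Longrightarrow> \<omega>' b c \<in> \<rat>"
    "\<And>x y. \<bar>\<omega>' x y - \<omega> x y\<bar> \<le> e * norm x * norm y"
proof -
  obtain K where K: "K > 0" "\<And>x. (\<Sum>b\<in>B. \<bar>coord b x\<bar>) \<le> K * norm x"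
    using sum_abs_coord_le by blast
  \<comment> \<open>An entrywise error \<open>d\<close> is multiplied by the coordinate sums of
    \<open>x\<close> and of \<open>y\<close>, each contributing a factor \<open>K\<close>.\<close>
  define d where "d = e / K\<^sup>2"
  have d: "d > 0" using e K by (simp add: d_def)
  have "\<exists>p\<in>\<rat>. \<bar>p - \<omega> b c\<bar> \<le> d" for b c
  proof -
    obtain p where "p \<in> \<rat>" "\<omega> b c - d < p" "p < \<omega> b c + d"
      using Rats_dense_in_real[of "\<omega> b c - d" "\<omega> b c + d"] d by auto
    then show ?thesis by (intro bexI[of _ p]) auto
  qed
  then obtain p where p: "\<And>b c. p b c \<in> \<rat>" "\<And>b c. \<bar>p b c - \<omega> b c\<bar> \<le> d"
    by metis
  have skew: "\<omega> c b = - \<omega> b c" for b c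
    using \<omega>(2)[of "b + c"] \<omega>(2)[of b] \<omega>(2)[of c]
    by (simp add: bilinear_ladd[OF \<omega>(1)] bilinear_radd[OF \<omega>(1)])
  \<comment> \<open>Rounding may destroy skewness. Both \<open>p b c\<close> and
    \<open>- p c b\<close> lie within \<open>d\<close> of \<omega>(b, c), so their mean does
    too.\<close>
  define q where "q b c = (p b c - p c b) / 2" for b c
  have q: "\<bar>q b c - \<omega> b c\<bar> \<le> d" for b c
    using p(2)[of b c] p(2)[of c b] skew[of b c] by (auto simp: q_def abs_le_iff field_simps)
  define f where "f x y = (\<Sum>b\<in>B. \<Sum>c\<in>B. coord b x * coord c y * q b c)" for x y
  show ?thesis
  proof (rule that[of f])
    show bil: "bilinear f" unfolding f_def by (rule bilinear_coord_sum)
    show "f x x = 0" for x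
    proof -
      have "f x x = (\<Sum>c\<in>B. \<Sum>b\<in>B. coord b x * coord c x * q b c)"
        unfolding f_def by (rule sum.swap)
      also have "\<dots> = - f x x"
        unfolding f_def sum_negf[symmetric]
        by (intro sum.cong) (auto simp: q_def field_simps)
      finally show ?thesis by simp
    qed
    show "f b c \<in> \<rat>" if b: "b \<in> B" and c: "c \<in> B" for b c
    proof -
      have "f b c = (\<Sum>b'\<in>B. \<Sum>c'\<in>B. if c' = c then (if b' = b then q b c else 0) else 0)"
        unfolding f_def by (intro sum.cong) (auto simp: coord_basis b c)
      also have "\<dots> = q b c" using finite_basis b c by simp
      finally have "f b c = (p b c - p c b) / 2" by (simp only: q_def)
      then show ?thesis using p(1) by (simp only: Rats_diff Rats_divide Rats_number_of)
    qed
    show "\<bar>f x y - \<omega> x y\<bar> \<le> e * norm x * norm y" for x y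
    proof -
      have "f x y - \<omega> x y = (\<Sum>b\<in>B. \<Sum>c\<in>B. coord b x * coord c y * (q b c - \<omega> b c))"
        unfolding f_def bilinear_coord_expansion[OF \<omega>(1), of x y]
        by (simp add: sum_subtractf right_diff_distrib)
      also have "\<bar>\<dots>\<bar> \<le> (\<Sum>b\<in>B. \<Sum>c\<in>B. \<bar>coord b x\<bar> * \<bar>coord c y\<bar> * d)"
        by (intro order.trans[OF sum_abs] sum_mono)
           (auto simp: abs_mult intro!: mult_left_mono q)
      also have "\<dots> = (\<Sum>b\<in>B. \<bar>coord b x\<bar>) * (\<Sum>c\<in>B. \<bar>coord c y\<bar>) * d"
        unfolding sum_product unfolding sum_distrib_right ..
      also have "\<dots> \<le> (K * norm x) * (K * norm y) * d"
        using K d by (intro mult_right_mono mult_mono sum_nonneg) auto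
      also have "\<dots> = e * norm x * norm y"
        using K by (simp add: d_def power2_eq_square)
      finally show ?thesis .
    qed
  qed
qed

end

section \<open>The action of the group on the scalar extension, and rational invariant forms\<close>

locale rational_representation = group G for G (structure) +
  fixes scl :: "rat \<Rightarrow> 'v::ab_group_add \<Rightarrow> 'v"
    and \<rho> :: "'a \<Rightarrow> 'v \<Rightarrow> 'v"
    and \<iota> :: "'v \<Rightarrow> 'w::real_normed_vector"
    and B :: "'v set"
  assumes finite_group: "finite (carrier G)"
    and action: "group_action G UNIV \<rho>"
    and linear_\<rho>: "g \<in> carrier G \<Longrightarrow> Vector_Spaces.linear scl scl (\<rho> g)"
    and ext: "scalar_extension scl \<iota>"
    and finite_B: "finite B"
    and span_B: "module.span scl B = UNIV"
    and basis: "independent (\<iota> ` B)" "span (\<iota> ` B) = UNIV"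
begin

text \<open>The same \<open>B\<close> does two jobs: it spans V over the rationals and so generates
  the lattice, and its image is the real basis for coordinates. Rationality of a form on V can
  therefore be read off its Gram matrix.\<close>

sublocale finite_real_basis "\<iota> ` B"
  using finite_B basis by unfold_locales auto

sublocale i: Vector_Spaces.linear scl scaleQ \<iota>
  using ext by (simp add: scalar_extension_def)

definition act :: "'a \<Rightarrow> 'w \<Rightarrow> 'w"
  where "act g = extend_scalars \<iota> (\<rho> g)"

lemma linear_act: "g \<in> carrier G \<Longrightarrow> linear (act g)"
  and act_\<iota>: "g \<in> carrier G \<Longrightarrow> act g (\<iota> v) = \<iota> (\<rho> g v)"
  unfolding act_def using extend_scalars[OF ext linear_\<rho>] by auto

text \<open>The image of V contains a real basis. Through this the laws of the action pass from
  \<rho> to \<open>act\<close>.\<close>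

lemma eq_on_\<iota>:
  assumes "linear S" "linear T" "\<And>v. S (\<iota> v) = T (\<iota> v)"
  shows "S w = T w"
  by (rule linear_eq_on[OF assms(1,2), of w "\<iota> ` B"]) (use assms(3) basis in auto)

lemma act_one: "act \<one> w = w"
proof (rule eq_on_\<iota>[of _ "\<lambda>w. w"])
  show "act \<one> (\<iota> v) = \<iota> v" for v
    using group_action.id_eq_one[OF action] by (simp add: act_\<iota>) (metis restrict_UNIV)
qed (auto simp: linear_act linear_ident)

lemma act_mult:
  assumes g: "g \<in> carrier G" and h: "h \<in> carrier G"
  shows "act (g \<otimes> h) w = act g (act h w)"
proof (rule eq_on_\<iota>[of _ "\<lambda>w. act g (act h w)"])
  show "linear (\<lambda>w. act g (act h w))"
    using linear_compose[OF linear_act[OF h] linear_act[OF g]] by (simp add: o_def)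
  show "act (g \<otimes> h) (\<iota> v) = act g (act h (\<iota> v))" for v
    using g h group_action.composition_rule[OF action _ g h] by (simp add: act_\<iota>)
qed (use g h linear_act in auto)

lemma surj_act: "g \<in> carrier G \<Longrightarrow> surj (act g)"
  by (rule surjI[of _ "act (inv g)"]) (simp add: act_mult[symmetric] act_one)

lemma sum_translate:
  fixes f :: "'a \<Rightarrow> 'c::comm_monoid_add"
  assumes h: "h \<in> carrier G"
  shows "(\<Sum>g\<in>carrier G. f (g \<otimes> h)) = (\<Sum>g\<in>carrier G. f g)"
  by (rule sum.reindex_bij_witness[of _ "\<lambda>g. g \<otimes> inv h" "\<lambda>g. g \<otimes> h"])
     (use h in \<open>auto simp: m_assoc\<close>)

lemma bilinear_act:
  assumes f: "bilinear f" and g: "g \<in> carrier G"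
  shows "bilinear (\<lambda>x y. f (act g x) (act g y))"
  using linear_act[OF g] unfolding bilinear_def
  by (auto intro!: linearI simp: linear_add linear_scale bilinear_ladd[OF f] bilinear_radd[OF f]
      bilinear_lmul[OF f] bilinear_rmul[OF f])

lemma rational_on_V:
  fixes f :: "'w \<Rightarrow> 'w \<Rightarrow> real"
  assumes f: "bilinear f" and B: "\<And>b c. b \<in> B \<Longrightarrow> c \<in> B \<Longrightarrow> f (\<iota> b) (\<iota> c) \<in> \<rat>"
  shows "f (\<iota> u) (\<iota> v) \<in> \<rat>"
proof -
  have *: "f (\<iota> b) (\<iota> v) \<in> \<rat>" if b: "b \<in> B" for b v
  proof -
    have "v \<in> i.vs1.span B" using span_B by simp
    then show ?thesis
      by (induction rule: i.vs1.span_induct_alt)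
         (use B b in \<open>auto simp: i.zero i.add i.scale bilinear_rzero[OF f] bilinear_radd[OF f]
           bilinear_rmul[OF f]\<close>)
  qed
  have "u \<in> i.vs1.span B" using span_B by simp
  then show ?thesis
    by (induction rule: i.vs1.span_induct_alt)
       (use * in \<open>auto simp: i.zero i.add i.scale bilinear_lzero[OF f] bilinear_ladd[OF f]
         bilinear_lmul[OF f]\<close>)
qed

lemma integral_on_lattice:
  fixes f :: "'w \<Rightarrow> 'w \<Rightarrow> real"
  assumes f: "bilinear f" and B: "\<And>b c. b \<in> B \<Longrightarrow> c \<in> B \<Longrightarrow> f (\<iota> b) (\<iota> c) \<in> \<int>"
    and u: "u \<in> group_closure B" and v: "v \<in> group_closure B"
  shows "f (\<iota> u) (\<iota> v) \<in> \<int>"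
proof -
  have *: "f (\<iota> b) (\<iota> v) \<in> \<int>" if b: "b \<in> B" for b
    using v by induction
      (use B b in \<open>auto simp: i.zero i.diff bilinear_rzero[OF f] bilinear_rsub[OF f]\<close>)
  show ?thesis
    using u by induction
      (use * in \<open>auto simp: i.zero i.diff bilinear_lzero[OF f] bilinear_lsub[OF f]\<close>)
qed

text \<open>Averaging keeps rationality, because the group maps V to itself and its order is an
  integer. It leaves \<omega> unchanged, so the new error is the average of the translated old
  errors.\<close>

lemma rational_invariant_approx:
  fixes \<omega> :: "'w \<Rightarrow> 'w \<Rightarrow> real"
  assumes \<omega>: "bilinear \<omega>" "\<And>x. \<omega> x x = 0"
      "\<And>g x y. g \<in> carrier G \<Longrightarrow> \<omega> (act g x) (act g y) = \<omega> x y"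
    and e: "e > 0"
  obtains \<omega>' where "bilinear \<omega>'" "\<And>x. \<omega>' x x = (0::real)"
    "\<And>g x y. g \<in> carrier G \<Longrightarrow> \<omega>' (act g x) (act g y) = \<omega>' x y"
    "\<And>u v. \<omega>' (\<iota> u) (\<iota> v) \<in> \<rat>"
    "\<And>x y. \<bar>\<omega>' x y - \<omega> x y\<bar> \<le> e * norm x * norm y"
proof -
  define N where "N = real (card (carrier G))"
  have N: "N > 0" unfolding N_def using finite_group by (auto simp: card_gt_0_iff)
  define M where "M = 1 + (\<Sum>g\<in>carrier G. (onorm (act g))\<^sup>2)"
  have M: "M > 0" unfolding M_def by (intro add_pos_nonneg sum_nonneg) auto
  have bl: "bounded_linear (act g)" if "g \<in> carrier G" for g
    using linear_act[OF that] by (rule linear_imp_bounded_linear)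
  \<comment> \<open>Averaging turns an error \<open>d\<close> into at most \<open>d M / N\<close>,
    which this choice makes equal to \<open>e\<close>. The summand 1 in \<open>M\<close> keeps it
    positive even if all operator norms vanish.\<close>
  define d where "d = e * N / M"
  have d: "d > 0" using e N M by (simp add: d_def)
  obtain f where f: "bilinear f" "\<And>x. f x x = (0::real)"
    "\<And>b c. b \<in> \<iota> ` B \<Longrightarrow> c \<in> \<iota> ` B \<Longrightarrow> f b c \<in> \<rat>"
    "\<And>x y. \<bar>f x y - \<omega> x y\<bar> \<le> d * norm x * norm y"
    using rational_alternating_approx[OF \<omega>(1,2) d] by blast
  define \<omega>' where "\<omega>' x y = (\<Sum>g\<in>carrier G. f (act g x) (act g y)) / N" for x y
  show ?thesis
  proof (rule that[of \<omega>'])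
    show "bilinear \<omega>'"
      unfolding bilinear_def \<omega>'_def
      by (auto intro!: linearI simp: bilinear_ladd[OF bilinear_act[OF f(1)]]
          bilinear_radd[OF bilinear_act[OF f(1)]] bilinear_lmul[OF bilinear_act[OF f(1)]]
          bilinear_rmul[OF bilinear_act[OF f(1)]] sum.distrib add_divide_distrib sum_distrib_left
          sum_divide_distrib)
    show "\<omega>' x x = 0" for x by (simp add: \<omega>'_def f(2))
    show "\<omega>' (act h x) (act h y) = \<omega>' x y" if h: "h \<in> carrier G" for h x y
      using sum_translate[OF h, of "\<lambda>g. f (act g x) (act g y)"] h
      by (simp add: \<omega>'_def act_mult)
    show "\<omega>' (\<iota> u) (\<iota> v) \<in> \<rat>" for u v
    proof -
      have "f (\<iota> u) (\<iota> v) \<in> \<rat>" for u v by (rule rational_on_V[OF f(1)]) (auto intro: f(3))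
      then show ?thesis unfolding \<omega>'_def N_def
        by (intro Rats_divide Rats_sum Rats_of_nat) (simp add: act_\<iota>)
    qed
    show "\<bar>\<omega>' x y - \<omega> x y\<bar> \<le> e * norm x * norm y" for x y
    proof -
      have "\<omega>' x y - \<omega> x y = (\<Sum>g\<in>carrier G. f (act g x) (act g y) - \<omega> (act g x) (act g y)) / N"
        using N by (simp add: \<omega>'_def sum_subtractf \<omega>(3) N_def field_simps)
      also have "\<bar>\<dots>\<bar> \<le> (\<Sum>g\<in>carrier G. d * (onorm (act g))\<^sup>2 * norm x * norm y) / N"
        using N d bl bilinear_bounded_linear_bound[of _ "\<lambda>x y. f x y - \<omega> x y" d, OF _ f(4)]
        unfolding abs_divide abs_of_pos[OF N]
        by (intro divide_right_mono order.trans[OF sum_abs] sum_mono) auto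
      also have "\<dots> = (\<Sum>g\<in>carrier G. (onorm (act g))\<^sup>2) * (d * norm x * norm y / N)"
        by (simp add: sum_distrib_left sum_distrib_right sum_divide_distrib mult_ac)
      also have "\<dots> \<le> M * (d * norm x * norm y / N)"
        unfolding M_def using d N by (intro mult_right_mono) auto
      also have "\<dots> = e * norm x * norm y"
        using M N by (simp add: d_def)
      finally show ?thesis .
    qed
  qed
qed

section \<open>Invariant complex structures and their compatible symplectic forms\<close>

abbreviation "\<D> \<equiv> invariant_complex_structures G \<rho> \<iota>"

lemma complex_structureD:
  assumes "J \<in> \<D>"
  shows "J (J x) = - x" "g \<in> carrier G \<Longrightarrow> J (act g x) = act g (J x)"
proof -
  have "J o\<^sub>L J = - id_blinfun" using assms by (simp add: invariant_complex_structures_def)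
  then have "blinfun_apply (J o\<^sub>L J) x = blinfun_apply (- id_blinfun) x" by (rule arg_cong)
  then show "J (J x) = - x" by (simp add: blinfun.minus_left)
  show "g \<in> carrier G \<Longrightarrow> J (act g x) = act g (J x)"
    using assms by (simp add: invariant_complex_structures_def act_def)
qed

text \<open>Since \<open>J\<close> commutes with the group and its square is -1, a sign that a
  bilinear form does not see, averaging over \<open>J\<close> needs only the two terms for the
  identity and \<open>J\<close>.\<close>

lemma compatible_form:
  assumes J: "J \<in> \<D>"
  obtains \<omega> where "bilinear \<omega>" "\<And>x. \<omega> x x = (0::real)"
    "\<And>x y. \<omega> (J x) (J y) = \<omega> x y" "\<And>x. x \<noteq> 0 \<Longrightarrow> \<omega> (J x) x > 0"
    "\<And>g x y. g \<in> carrier G \<Longrightarrow> \<omega> (act g x) (act g y) = \<omega> x y"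
proof -
  note JJ = complex_structureD(1)[OF J] and Jact = complex_structureD(2)[OF J]
  \<comment> \<open>The norm need not come from an inner product, so one is built by declaring the
    basis orthonormal.\<close>
  define h0 where "h0 x y = (\<Sum>b\<in>\<iota> ` B. coord b x * coord b y)" for x y
  have h0: "bilinear h0"
    unfolding bilinear_def h0_def
    by (auto intro!: linearI simp: linear_add[OF linear_coord] linear_scale[OF linear_coord]
        algebra_simps sum.distrib sum_distrib_left)
  have h0_nonneg: "h0 x x \<ge> 0" for x unfolding h0_def by (intro sum_nonneg) auto
  have h0_pos: "h0 x x > 0" if "x \<noteq> 0" for x
  proof -
    have "h0 x x \<noteq> 0"
    proof
      assume "h0 x x = 0"
      then have "\<forall>b\<in>\<iota> ` B. coord b x = 0"
        unfolding h0_def using finite_basis by (subst (asm) sum_nonneg_eq_0_iff) auto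
      then have "(\<Sum>b\<in>\<iota> ` B. coord b x *\<^sub>R b) = 0" by (intro sum.neutral) auto
      with that show False by (simp only: sum_coord)
    qed
    with h0_nonneg[of x] show ?thesis by simp
  qed
  have h0_sym: "h0 x y = h0 y x" for x y by (simp add: h0_def mult.commute)
  define h where
    "h x y = (\<Sum>g\<in>carrier G. h0 (act g x) (act g y) + h0 (act g (J x)) (act g (J y)))" for x y
  have h: "bilinear h"
    unfolding bilinear_def h_def
    by (auto intro!: linearI simp: blinfun.add_right blinfun.scaleR_right
        bilinear_ladd[OF bilinear_act[OF h0]]
        bilinear_radd[OF bilinear_act[OF h0]] bilinear_lmul[OF bilinear_act[OF h0]]
        bilinear_rmul[OF bilinear_act[OF h0]] sum.distrib sum_distrib_left distrib_left)
  have h_sym: "h x y = h y x" for x y unfolding h_def by (simp add: h0_sym)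
  have h_pos: "h x x > 0" if "x \<noteq> 0" for x
    unfolding h_def
  \<comment> \<open>The summand of the neutral element is already positive; the others are
    nonnegative.\<close>
  proof (rule sum_pos2[OF finite_group one_closed])
    show "h0 (act \<one> x) (act \<one> x) + h0 (act \<one> (J x)) (act \<one> (J x)) > 0"
      unfolding act_one using h0_pos[OF that] h0_nonneg[of "J x"] by simp
  qed (simp add: h0_nonneg)
  have h_J: "h (J x) (J y) = h x y" for x y
    unfolding h_def JJ
    \<comment> \<open>Applying \<open>J\<close> swaps the two terms of each summand, up to replacing
      both arguments by their negatives.\<close>
    by (rule sum.cong) (simp_all add: linear_neg[OF linear_act] bilinear_lneg[OF h0] bilinear_rneg[OF h0])
  have h_act: "h (act k x) (act k y) = h x y" if k: "k \<in> carrier G" for k x y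
    using sum_translate[OF k, of "\<lambda>g. h0 (act g x) (act g y) + h0 (act g (J x)) (act g (J y))"] k
    by (simp add: h_def act_mult Jact)
  show ?thesis
  proof (rule that[of "\<lambda>x y. h x (J y)"])
    show "bilinear (\<lambda>x y. h x (J y))"
      unfolding bilinear_def
      by (auto intro!: linearI simp: blinfun.add_right blinfun.scaleR_right
        bilinear_ladd[OF h] bilinear_radd[OF h] bilinear_lmul[OF h] bilinear_rmul[OF h])
    show "h x (J x) = 0" for x
      \<comment> \<open>By invariance h(x, Jx) = h(Jx, -x), and by symmetry this is -h(x,
        Jx).\<close>
      using h_J[of x "J x"] h_sym[of "J x" x] by (simp add: JJ bilinear_rneg[OF h])
    show "h (J x) (J (J y)) = h x (J y)" for x y by (rule h_J)
    show "h (J x) (J x) > 0" if "x \<noteq> 0" for x using h_pos[OF that] by (simp add: h_J)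
    show "h (act g x) (J (act g y)) = h x (J y)" if "g \<in> carrier G" for g x y
      using that by (simp add: Jact h_act)
  qed
qed

section \<open>Polarisable conjugates\<close>

text \<open>Here \<open>S\<close> inverts \<open>id + Z\<close>, so the result is a conjugate of
  \<open>J\<close>. The inverse commutes with the group because \<open>Z\<close> does.\<close>

lemma conjugate_complex_structure:
  fixes S Z :: "'w \<Rightarrow>\<^sub>L 'w"
  assumes J: "J \<in> \<D>"
    and S: "\<And>x. S x + Z (S x) = x" "\<And>x. S (x + Z x) = x"
    and Z: "\<And>g x. g \<in> carrier G \<Longrightarrow> Z (act g x) = act g (Z x)"
  shows "S o\<^sub>L J o\<^sub>L (id_blinfun + Z) \<in> \<D>"
proof -
  have S_act: "S (act g x) = act g (S x)" if g: "g \<in> carrier G" for g x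
  proof -
    have "S (act g x) = S (act g (S x + Z (S x)))" by (simp only: S(1))
    also have "\<dots> = S (act g (S x) + Z (act g (S x)))"
      by (simp only: linear_add[OF linear_act[OF g]] Z[OF g])
    finally show ?thesis by (simp only: S(2))
  qed
  let ?K = "S o\<^sub>L J o\<^sub>L (id_blinfun + Z)"
  have "?K (?K x) = - x" for x
  proof -
    have "?K (?K x) = S (J (S (J (x + Z x)) + Z (S (J (x + Z x)))))"
      by (simp add: blinfun.add_left)
    then show ?thesis
      by (simp only: S complex_structureD(1)[OF J] blinfun.minus_right)
  qed
  then have "?K o\<^sub>L ?K = - id_blinfun"
    by (intro blinfun_eqI) (simp add: blinfun.minus_left)
  moreover have "?K (act g x) = act g (?K x)" if g: "g \<in> carrier G" for g x
    using g by (simp add: blinfun.add_left S_act Z complex_structureD(2)[OF J]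
        flip: linear_add[OF linear_act[OF g]])
  ultimately show ?thesis
    by (simp add: invariant_complex_structures_def act_def)
qed

text \<open>The path takes \<open>r = 1/2\<close>, and density takes \<open>r\<close> small.
  Quantifying over the inverse \<open>S\<close> lets each argument supply its own.\<close>

lemma polarisable_conjugate:
  assumes J: "J \<in> \<D>" and r: "0 < r" "r \<le> 1/2"
  obtains Y :: "'w \<Rightarrow>\<^sub>L 'w" where "norm Y \<le> r"
    and "\<forall>g\<in>carrier G. \<forall>x. Y (act g x) = act g (Y x)"
    and "\<forall>S. (\<forall>x. blinfun_apply S x + Y (blinfun_apply S x) = x) \<longrightarrow>
      (\<forall>x. blinfun_apply S (x + Y x) = x) \<longrightarrow>
      polarisable scl \<iota> (S o\<^sub>L J o\<^sub>L (id_blinfun + Y))"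
proof -
  obtain \<omega> where \<omega>: "bilinear \<omega>" "\<And>x. \<omega> x x = (0::real)"
    "\<And>x y. \<omega> (J x) (J y) = \<omega> x y" "\<And>x. x \<noteq> 0 \<Longrightarrow> \<omega> (J x) x > 0"
    "\<And>g x y. g \<in> carrier G \<Longrightarrow> \<omega> (act g x) (act g y) = \<omega> x y"
    using compatible_form[OF J] by blast
  have nondeg: "x = 0" if "\<And>y. \<omega> x y = 0" for x
  proof (rule ccontr)
    assume "x \<noteq> 0"
    \<comment> \<open>The vector \<open>J x\<close> detects \<open>x\<close>: positivity at
      \<open>J x\<close> says -\<omega>(x, Jx) > 0.\<close>
    then have "J x \<noteq> 0"
      using complex_structureD(1)[OF J, of x] by auto
    then have "\<omega> (J (J x)) (J x) > 0" by (rule \<omega>(4))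
    with that[of "J x"] show False
      by (simp add: complex_structureD(1)[OF J] bilinear_lneg[OF \<omega>(1)])
  qed
  obtain \<delta> where \<delta>: "\<delta> > 0" and sqrt:
    "\<forall>\<eta>. bilinear \<eta> \<longrightarrow> (\<forall>x. \<eta> x x = 0) \<longrightarrow> (\<forall>x y. \<bar>\<eta> x y\<bar> \<le> \<delta> * norm x * norm y) \<longrightarrow>
      (\<exists>Y. norm Y \<le> r \<and>
        (\<forall>x y. \<omega> (x + blinfun_apply Y x) (y + blinfun_apply Y y) = \<omega> x y + \<eta> x y) \<and>
        (\<forall>E. linear E \<longrightarrow> surj E \<longrightarrow> (\<forall>x y. \<omega> (E x) (E y) = \<omega> x y) \<longrightarrow>
          (\<forall>x y. \<eta> (E x) (E y) = \<eta> x y) \<longrightarrow> (\<forall>x. blinfun_apply Y (E x) = E (blinfun_apply Y x))))"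
    by (rule alternating_perturbation[OF \<omega>(1,2) nondeg r])
  obtain \<omega>' where \<omega>': "bilinear \<omega>'" "\<And>x. \<omega>' x x = (0::real)"
    "\<And>g x y. g \<in> carrier G \<Longrightarrow> \<omega>' (act g x) (act g y) = \<omega>' x y"
    "\<And>u v. \<omega>' (\<iota> u) (\<iota> v) \<in> \<rat>"
    "\<And>x y. \<bar>\<omega>' x y - \<omega> x y\<bar> \<le> \<delta> * norm x * norm y"
    using rational_invariant_approx[OF \<omega>(1,2,5) \<delta>] by blast
  have "bilinear (\<lambda>x y. \<omega>' x y - \<omega> x y)"
    using \<omega>(1) \<omega>'(1) unfolding bilinear_def by (auto intro: linear_compose_sub)
  then have "\<exists>Y. norm Y \<le> r \<and>
        (\<forall>x y. \<omega> (x + blinfun_apply Y x) (y + blinfun_apply Y y) = \<omega> x y + (\<omega>' x y - \<omega> x y)) \<and>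
        (\<forall>E. linear E \<longrightarrow> surj E \<longrightarrow> (\<forall>x y. \<omega> (E x) (E y) = \<omega> x y) \<longrightarrow>
          (\<forall>x y. \<omega>' (E x) (E y) - \<omega> (E x) (E y) = \<omega>' x y - \<omega> x y) \<longrightarrow>
          (\<forall>x. blinfun_apply Y (E x) = E (blinfun_apply Y x)))"
    by (rule sqrt[rule_format]) (simp_all add: \<omega>(2) \<omega>'(2,5))
  then obtain Y where Y: "norm Y \<le> r"
      "\<forall>x y. \<omega> (x + blinfun_apply Y x) (y + blinfun_apply Y y) = \<omega> x y + (\<omega>' x y - \<omega> x y)"
    and comm: "\<forall>E. linear E \<longrightarrow> surj E \<longrightarrow> (\<forall>x y. \<omega> (E x) (E y) = \<omega> x y) \<longrightarrow>
          (\<forall>x y. \<omega>' (E x) (E y) - \<omega> (E x) (E y) = \<omega>' x y - \<omega> x y) \<longrightarrow>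
          (\<forall>x. blinfun_apply Y (E x) = E (blinfun_apply Y x))"
    by (elim exE conjE)
  have \<omega>'_eq: "\<omega>' x y = \<omega> (x + blinfun_apply Y x) (y + blinfun_apply Y y)" for x y
    using Y(2) by simp
  have "finite ((\<lambda>(b, c). \<omega>' (\<iota> b) (\<iota> c)) ` (B \<times> B))"
    "(\<lambda>(b, c). \<omega>' (\<iota> b) (\<iota> c)) ` (B \<times> B) \<subseteq> \<rat>"
    using finite_B \<omega>'(4) by auto
  from finite_rationals_common_denominator[OF this] obtain D :: nat where D: "D > 0"
    "\<And>b c. b \<in> B \<Longrightarrow> c \<in> B \<Longrightarrow> real D * \<omega>' (\<iota> b) (\<iota> c) \<in> \<int>"
    by (auto simp: image_iff)
  \<comment> \<open>Scaling by the common denominator \<open>D\<close> makes the form integral on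
    the lattice generated by \<open>B\<close>; as \<open>D\<close> is positive, the other conditions
    survive.\<close>
  define f where "f x y = real D * \<omega>' x y" for x y
  have f: "bilinear f"
    unfolding bilinear_def f_def
    by (auto intro!: linearI simp: bilinear_ladd[OF \<omega>'(1)] bilinear_radd[OF \<omega>'(1)]
        bilinear_lmul[OF \<omega>'(1)] bilinear_rmul[OF \<omega>'(1)] distrib_left)
  show ?thesis
  proof (rule that[OF Y(1)])
    show "\<forall>g\<in>carrier G. \<forall>x. Y (act g x) = act g (Y x)"
      using comm linear_act surj_act by (simp add: \<omega>(5) \<omega>'(3))
  next
    have "polarisable scl \<iota> (S o\<^sub>L J o\<^sub>L (id_blinfun + Y))"
      if S: "\<And>x. blinfun_apply S x + Y (blinfun_apply S x) = x" "\<And>x. blinfun_apply S (x + Y x) = x" for S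
    proof -
      let ?K = "S o\<^sub>L J o\<^sub>L (id_blinfun + Y)"
      \<comment> \<open>The map \<open>id + Y\<close> carries \<open>?K\<close> to \<open>J\<close>
        and the rational form to \<omega>, so compatibility and positivity are inherited from
        \<open>J\<close> and \<omega>.\<close>
      have K: "?K x + Y (?K x) = J (x + Y x)" for x
        by (simp add: blinfun.add_left S)
      show "polarisable scl \<iota> ?K"
        unfolding polarisable_def
      proof (intro exI[of _ f] conjI allI impI)
        show "f x x = 0" for x by (simp add: f_def \<omega>'(2))
        show "f (?K x) (?K y) = f x y" for x y
          unfolding f_def \<omega>'_eq K \<omega>(3) ..
        show "f (?K x) x > 0" if "x \<noteq> 0" for x
        proof -
          have "x + Y x \<noteq> 0" using S(2)[of x] that by (metis blinfun.zero_right)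
          then show ?thesis
            unfolding f_def \<omega>'_eq K using D(1) \<omega>(4) by simp
        qed
        have "rational_lattice scl (group_closure B)"
          unfolding rational_lattice_def
        proof (intro conjI exI[of _ B])
          have "B \<subseteq> group_closure B" by (auto intro: group_closure.base)
          then show "module.span scl (group_closure B) = UNIV"
            using i.vs1.span_mono span_B by blast
        qed (use finite_B in auto)
        then show "\<exists>\<Lambda>. rational_lattice scl \<Lambda> \<and> (\<forall>a\<in>\<Lambda>. \<forall>b\<in>\<Lambda>. f (\<iota> a) (\<iota> b) \<in> \<int>)"
          using integral_on_lattice[OF f] D(2) by (auto simp: f_def)
      qed (rule f)
    qed
    then show "\<forall>S. (\<forall>x. blinfun_apply S x + Y (blinfun_apply S x) = x) \<longrightarrow>
      (\<forall>x. blinfun_apply S (x + Y x) = x) \<longrightarrow>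
      polarisable scl \<iota> (S o\<^sub>L J o\<^sub>L (id_blinfun + Y))"
      by blast
  qed
qed

section \<open>The path to a polarisable structure, and density\<close>

lemma deformation_to_polarisable:
  assumes J: "J \<in> \<D>"
  shows "\<exists>J' \<gamma>. J' \<in> \<D> \<and> polarisable scl \<iota> J' \<and> continuous_on {0..1::real} \<gamma> \<and>
    \<gamma> ` {0..1} \<subseteq> \<D> \<and> \<gamma> 0 = J \<and> \<gamma> 1 = J'"
proof -
  \<comment> \<open>Norm at most 1/2 keeps every \<open>id + t Y\<close> with t in [0, 1]
    invertible, with an inverse of norm at most 2.\<close>
  obtain Y :: "'w \<Rightarrow>\<^sub>L 'w" where Y: "norm Y \<le> 1/2"
    "\<forall>g\<in>carrier G. \<forall>x. Y (act g x) = act g (Y x)"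
    "\<forall>S. (\<forall>x. blinfun_apply S x + Y (blinfun_apply S x) = x) \<longrightarrow>
      (\<forall>x. blinfun_apply S (x + Y x) = x) \<longrightarrow>
      polarisable scl \<iota> (S o\<^sub>L J o\<^sub>L (id_blinfun + Y))"
    by (rule polarisable_conjugate[OF J, of "1/2"]) simp_all
  \<comment> \<open>The condition on \<open>t\<close> sits inside the existential so that choice
    yields a function \<open>S\<close> on all reals.\<close>
  have ex: "\<forall>t::real. \<exists>S. t \<in> {0..1} \<longrightarrow> norm S \<le> 2 \<and>
      (\<forall>x. blinfun_apply S x + t *\<^sub>R blinfun_apply Y (blinfun_apply S x) = x) \<and>
      (\<forall>x. blinfun_apply S (x + t *\<^sub>R blinfun_apply Y x) = x)"
  proof
    fix t :: real
    show "\<exists>S. t \<in> {0..1} \<longrightarrow> norm S \<le> 2 \<and>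
      (\<forall>x. blinfun_apply S x + t *\<^sub>R blinfun_apply Y (blinfun_apply S x) = x) \<and>
      (\<forall>x. blinfun_apply S (x + t *\<^sub>R blinfun_apply Y x) = x)"
    proof (cases "t \<in> {0..1}")
      case True
      then have "norm (t *\<^sub>R Y) \<le> 1 * (1/2)"
        unfolding norm_scaleR using Y(1) by (intro mult_mono) auto
      then have "norm (t *\<^sub>R Y) \<le> 1/2" by simp
      then obtain S :: "'w \<Rightarrow>\<^sub>L 'w" where "norm S \<le> 1 / (1 - 1/2)" "\<forall>x. S x + (t *\<^sub>R Y) (S x) = x"
          "\<forall>x. S (x + (t *\<^sub>R Y) x) = x"
        by (rule inverse_near_identity) simp
      then show ?thesis by (intro exI[of _ S]) (simp add: blinfun.scaleR_left)
    qed auto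
  qed
  from choice[OF ex] obtain S where "\<forall>t::real. t \<in> {0..1} \<longrightarrow> norm (S t) \<le> 2 \<and>
      (\<forall>x. blinfun_apply (S t) x + t *\<^sub>R blinfun_apply Y (blinfun_apply (S t) x) = x) \<and>
      (\<forall>x. blinfun_apply (S t) (x + t *\<^sub>R blinfun_apply Y x) = x)"
    by (elim exE)
  then have S: "\<And>t. t \<in> {0..1} \<Longrightarrow> norm (S t) \<le> 2"
    "\<And>t x. t \<in> {0..1} \<Longrightarrow> S t x + t *\<^sub>R Y (S t x) = x"
    "\<And>t x. t \<in> {0..1} \<Longrightarrow> S t (x + t *\<^sub>R Y x) = x"
    for t x by simp_all
  have "2-lipschitz_on {0..1} S"
  proof (rule lipschitz_onI)
    fix s t :: real
    assume s: "s \<in> {0..1}" and t: "t \<in> {0..1}"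
    \<comment> \<open>The resolvent identity. With the norm bounds 2, 1/2 and 2 it gives the
      Lipschitz constant 2.\<close>
    have "S s - S t = (t - s) *\<^sub>R (S s o\<^sub>L Y o\<^sub>L S t)"
    proof (rule blinfun_eqI)
      fix x
      have "S s x = S s (S t x + t *\<^sub>R Y (S t x))" using S(2)[OF t] by simp
      also have "\<dots> = S s ((S t x + s *\<^sub>R Y (S t x)) + (t - s) *\<^sub>R Y (S t x))"
        by (simp add: algebra_simps)
      also have "\<dots> = S t x + (t - s) *\<^sub>R S s (Y (S t x))"
        by (simp only: blinfun.add_right[of _ "_ + _"] S(3)[OF s] blinfun.scaleR_right)
      finally show "(S s - S t) x = ((t - s) *\<^sub>R (S s o\<^sub>L Y o\<^sub>L S t)) x"
        by (simp add: blinfun.diff_left blinfun.scaleR_left)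
    qed
    also have "norm \<dots> \<le> \<bar>t - s\<bar> * ((norm (S s) * norm Y) * norm (S t))"
      unfolding norm_scaleR
      by (intro mult_left_mono order.trans[OF norm_blinfun_compose] mult_right_mono norm_blinfun_compose) auto
    also have "\<dots> \<le> \<bar>t - s\<bar> * ((2 * (1/2)) * 2)"
      using S(1)[OF s] S(1)[OF t] Y(1) by (intro mult_left_mono mult_mono) auto
    finally show "dist (S s) (S t) \<le> 2 * dist s t"
      by (simp add: dist_norm abs_minus_commute)
  qed auto
  then have contS: "continuous_on {0..1} S" by (rule lipschitz_on_continuous_on)
  define \<gamma> where "\<gamma> t = (S t o\<^sub>L J o\<^sub>L (id_blinfun + t *\<^sub>R Y))" for t
  have \<gamma>_mem: "\<gamma> t \<in> \<D>" if t: "t \<in> {0..1}" for t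
    unfolding \<gamma>_def using S(2,3)[OF t] Y(2) linear_act
    by (intro conjugate_complex_structure[OF J]) (auto simp: blinfun.scaleR_left linear_scale)
  have "S 0 = id_blinfun" by (rule blinfun_eqI) (use S(3)[of 0] in simp)
  then have "\<gamma> 0 = J" unfolding \<gamma>_def by (intro blinfun_eqI) simp
  moreover have "polarisable scl \<iota> (\<gamma> 1)"
    unfolding \<gamma>_def using S(2,3)[of 1] Y(3) by simp
  moreover have "continuous_on {0..1} \<gamma>"
    unfolding \<gamma>_def by (intro continuous_intros contS)
  ultimately show ?thesis using \<gamma>_mem by (intro exI[of _ "\<gamma> 1"] exI[of _ \<gamma>]) auto
qed

lemma polarisable_dense: "\<D> \<subseteq> closure {K \<in> \<D>. polarisable scl \<iota> K}"
proof
  fix J assume J: "J \<in> \<D>"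
  show "J \<in> closure {K \<in> \<D>. polarisable scl \<iota> K}"
    unfolding closure_approachable
  proof (intro allI impI)
    fix e :: real assume e: "e > 0"
    \<comment> \<open>The bound 1/2 ensures invertibility; the other makes the final estimate
      \<open>4 * (norm J + 1) * r\<close> at most e/2. Adding 1 avoids division by zero when
      \<open>J\<close> is 0, in dimension zero.\<close>
    define r where "r = min (1/2) (e / (8 * (norm J + 1)))"
    have J1: "norm J + 1 > 0" by (simp add: add_nonneg_pos)
    have r: "0 < r" using e J1 by (simp add: r_def)
    have r2: "r \<le> 1/2" unfolding r_def by (rule min.cobounded1)
    obtain Y :: "'w \<Rightarrow>\<^sub>L 'w" where Y: "norm Y \<le> r"
      "\<forall>g\<in>carrier G. \<forall>x. Y (act g x) = act g (Y x)"
      "\<forall>S. (\<forall>x. blinfun_apply S x + Y (blinfun_apply S x) = x) \<longrightarrow>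
      (\<forall>x. blinfun_apply S (x + Y x) = x) \<longrightarrow>
        polarisable scl \<iota> (S o\<^sub>L J o\<^sub>L (id_blinfun + Y))"
      by (rule polarisable_conjugate[OF J r r2])
    have "norm Y \<le> 1/2" using Y(1) r2 by linarith
    then obtain S :: "'w \<Rightarrow>\<^sub>L 'w" where "norm S \<le> 1 / (1 - 1/2)" "\<forall>x. S x + Y (S x) = x" "\<forall>x. S (x + Y x) = x"
      by (rule inverse_near_identity) simp
    then have S: "norm S \<le> 2" "S x + Y (S x) = x" "S (x + Y x) = x" for x by simp_all
    let ?K = "S o\<^sub>L J o\<^sub>L (id_blinfun + Y)"
    \<comment> \<open>A conjugate differs from \<open>J\<close> only by a commutator with
      \<open>Y\<close>, hence by a multiple of the norm of \<open>Y\<close>.\<close>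
    have "?K - J = S o\<^sub>L ((J o\<^sub>L Y) - (Y o\<^sub>L J))"
    proof (rule blinfun_eqI)
      fix x
      have "S (Y (J x)) = J x - S (J x)"
        using S(3)[of "J x"] by (simp add: blinfun.add_right eq_diff_eq add.commute)
      then show "(?K - J) x = (S o\<^sub>L ((J o\<^sub>L Y) - (Y o\<^sub>L J))) x"
        by (simp add: blinfun.add_left blinfun.diff_left blinfun.diff_right blinfun.add_right)
    qed
    then have "dist ?K J \<le> norm S * norm ((J o\<^sub>L Y) - (Y o\<^sub>L J))"
      unfolding dist_norm by (simp add: norm_blinfun_compose)
    also have "\<dots> \<le> 2 * (norm J * norm Y + norm Y * norm J)"
      by (intro mult_mono S(1) order.trans[OF norm_triangle_ineq4] add_mono norm_blinfun_compose) auto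
    also have "\<dots> = 4 * norm J * norm Y" by simp
    also have "\<dots> \<le> 4 * (norm J + 1) * r"
      using Y(1) by (intro mult_mono) auto
    also have "\<dots> \<le> 4 * (norm J + 1) * (e / (8 * (norm J + 1)))"
      using J1 by (intro mult_left_mono) (auto simp: r_def)
    also have "\<dots> = e / 2" using less_imp_neq[OF J1] by (simp add: divide_simps)
    also have "\<dots> < e" using e by simp
    finally show "\<exists>K\<in>{K \<in> \<D>. polarisable scl \<iota> K}. dist K J < e"
      using conjugate_complex_structure[OF J S(2,3)] Y(2,3) S(2,3) by (intro bexI[of _ ?K]) auto
  qed
qed

end

theorem theorem1p10:
  fixes G :: "('g, 'm) monoid_scheme"
    and scl :: "rat \<Rightarrow> 'v::ab_group_add \<Rightarrow> 'v"
    and \<rho> :: "'g \<Rightarrow> 'v \<Rightarrow> 'v"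
    and \<iota> :: "'v \<Rightarrow> 'w::real_normed_vector"
    and J :: "'w \<Rightarrow>\<^sub>L 'w"
  assumes "group G" and "finite (carrier G)"
    and "fin_dim_rational_module G scl \<rho>"
    and "scalar_extension scl \<iota>"
    and "J \<in> invariant_complex_structures G \<rho> \<iota>"
  shows "(\<exists>J' \<gamma>. J' \<in> invariant_complex_structures G \<rho> \<iota> \<and> polarisable scl \<iota> J' \<and>
            continuous_on {0..1::real} \<gamma> \<and>
            \<gamma> ` {0..1} \<subseteq> invariant_complex_structures G \<rho> \<iota> \<and>
            \<gamma> 0 = J \<and> \<gamma> 1 = J') \<and>
         invariant_complex_structures G \<rho> \<iota> \<subseteq>
           closure {K \<in> invariant_complex_structures G \<rho> \<iota>. polarisable scl \<iota> K}"
proof -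
  obtain B0 where "finite_dimensional_vector_space scl B0"
    using assms(3) unfolding fin_dim_rational_module_def by blast
  then interpret V: finite_dimensional_vector_space scl B0 .
  \<comment> \<open>The working basis is the one supplied by the scalar extension, whose image is a
    real basis. The basis \<open>B0\<close> serves to show that the independent set \<open>B\<close>
    is finite.\<close>
  obtain B where B: "\<not> V.dependent B" "V.span B = UNIV" "independent (\<iota> ` B)" "span (\<iota> ` B) = UNIV"
    using assms(4) unfolding scalar_extension_def by blast
  interpret group G by fact
  interpret rational_representation G scl \<rho> \<iota> B
  proof (intro rational_representation.intro rational_representation_axioms.intro)
    show "group_action G UNIV \<rho>"
      using assms(3) by (simp add: fin_dim_rational_module_def)
    show "Vector_Spaces.linear scl scl (\<rho> g)"
      if "g \<in> carrier G" for g
      using assms(3) that by (simp add: fin_dim_rational_module_def)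
  qed (fact assms B V.finiteI_independent[OF B(1)])+
  show ?thesis using deformation_to_polarisable[OF assms(5)] polarisable_dense by blast
qed

end
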